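(* In any locally compact group $G$, the set of relatively amenable closed subgroups (i.e. closed subgroups that are amenable relative to $G$) is Chabauty-closed, that is, closed in the space of all closed subgroups of $G$ endowed with the Chabauty topology.
   Context: A convex compact $G$-space is a convex compact subset $K$ of any (Hausdorff) locally convex topological vector space endowed with a continuous affine representation of $G$ preserving $K$ (thus $G$ acts on $K$ by affine transformations, with continuous action map $G\times K\to K$). A closed subgroup $H<G$ is amenable relative to $G$ if $H$ fixes a point in every non-empty convex compact $G$-space. The Chabauty topology on the set of closed subgroups of $G$ is the compact Hausdorff topology generated by the sets $\{L: L\cap Q=\emptyset\}$ for $Q\subseteq G$ compact and $\{L: L\cap U\neq\emptyset\}$ for $U\subseteq G$ open. *)

theory Defs
  imports "HOL-Analysis.Analysis" "HOL-Algebra.Group_Action" "HOL-Algebra.Module"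
    "HOL-Algebra.Algebraic_Closure_Type"
begin

section \<open>Locally compact groups and the Chabauty topology\<close>

locale topological_group = group G for G (structure) and T +
  assumes topspace_eq_carrier: "topspace T = carrier G"
    and continuous_mult: "continuous_map (prod_topology T T) T (\<lambda>(x, y). x \<otimes> y)"
    and continuous_inv: "continuous_map T T (\<lambda>x. inv x)"

locale locally_compact_group = topological_group G T for G (structure) and T +
  assumes Hausdorff: "Hausdorff_space T"
    and locally_compact: "locally_compact_space T"

definition closed_subgroups :: "('g, 'm) monoid_scheme \<Rightarrow> 'g topology \<Rightarrow> 'g set set" where
  "closed_subgroups G T = {L. subgroup L G \<and> closedin T L}"

definition chabauty_topology :: "('g, 'm) monoid_scheme \<Rightarrow> 'g topology \<Rightarrow> 'g set topology" where
  "chabauty_topology G T = topology_generated_by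
     ({{L \<in> closed_subgroups G T. L \<inter> Q = {}} | Q. compactin T Q} \<union>
      {{L \<in> closed_subgroups G T. L \<inter> U \<noteq> {}} | U. openin T U})"

lemma topspace_chabauty_topology:
  "topspace (chabauty_topology G T) = closed_subgroups G T"
proof -
  have "{L \<in> closed_subgroups G T. L \<inter> {} = {}} \<in>
      {{L \<in> closed_subgroups G T. L \<inter> Q = {}} | Q. compactin T Q}"
    using compactin_empty by blast
  then show ?thesis
    unfolding chabauty_topology_def by auto
qed


section \<open>Convex compact G-spaces\<close>

abbreviation real_field :: "real ring" where
  "real_field \<equiv> ring_of_type_algebra"

definition convex_in :: "(real, 'v, 'm) module_scheme \<Rightarrow> 'v set \<Rightarrow> bool" where
  "convex_in V S \<longleftrightarrow> S \<subseteq> carrier V \<and>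
     (\<forall>x\<in>S. \<forall>y\<in>S. \<forall>t. 0 \<le> t \<and> t \<le> 1 \<longrightarrow> ((1 - t) \<odot>\<^bsub>V\<^esub> x) \<oplus>\<^bsub>V\<^esub> (t \<odot>\<^bsub>V\<^esub> y) \<in> S)"

definition affine_on :: "(real, 'v, 'm) module_scheme \<Rightarrow> ('v \<Rightarrow> 'v) \<Rightarrow> bool" where
  "affine_on V f \<longleftrightarrow> (\<forall>x\<in>carrier V. \<forall>y\<in>carrier V. \<forall>t.
     f (((1 - t) \<odot>\<^bsub>V\<^esub> x) \<oplus>\<^bsub>V\<^esub> (t \<odot>\<^bsub>V\<^esub> y)) = ((1 - t) \<odot>\<^bsub>V\<^esub> f x) \<oplus>\<^bsub>V\<^esub> (t \<odot>\<^bsub>V\<^esub> f y))"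

text \<open>
  Vector spaces live on carrier sets rather than on types, because the definition of relative
  amenability quantifies over all of them. The multiplication and unit that a module record
  inherits from rings play no role.
\<close>

locale hausdorff_lctvs = module real_field V for V (structure) and \<tau> +
  assumes topspace_eq_carrier: "topspace \<tau> = carrier V"
    and Hausdorff: "Hausdorff_space \<tau>"
    and continuous_add: "continuous_map (prod_topology \<tau> \<tau>) \<tau> (\<lambda>(x, y). x \<oplus> y)"
    and continuous_smult: "continuous_map (prod_topology euclideanreal \<tau>) \<tau> (\<lambda>(a, x). a \<odot> x)"
    and locally_convex: "neighbourhood_base_of (convex_in V) \<tau>"

locale convex_compact_G_space =
  G: topological_group G T + V: hausdorff_lctvs V \<tau> + act: group_action G "carrier V" \<phi>
  for G (structure) and T and V (structure) and \<tau> and \<phi> and K +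
  assumes affine_action: "g \<in> carrier G \<Longrightarrow> affine_on V (\<phi> g)"
    and continuous_action: "continuous_map (prod_topology T \<tau>) \<tau> (\<lambda>(g, v). \<phi> g v)"
    and convex: "convex_in V K"
    and compact: "compactin \<tau> K"
    and preserved: "g \<in> carrier G \<Longrightarrow> \<phi> g ` K \<subseteq> K"


section \<open>Relative amenability\<close>

text \<open>
  A definition cannot quantify over the type that carries the vector spaces, so it is first given
  as a parameter. For \<open>amenable_relative\<close> this type is chosen large enough that nothing
  is lost: the lemma \<open>amenable_relative_fixes_point\<close> below shows that a fixed point then
  exists in every non-empty convex compact G-space, whatever the type of its vectors.
\<close>

definition fixes_points_over ::
    "'v itself \<Rightarrow> ('g, 'm) monoid_scheme \<Rightarrow> 'g topology \<Rightarrow> 'g set \<Rightarrow> bool" where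
  "fixes_points_over _ G T H \<longleftrightarrow>
     (\<forall>(V :: (real, 'v) module) \<tau> \<phi> K. convex_compact_G_space G T V \<tau> \<phi> K \<and> K \<noteq> {} \<longrightarrow>
        (\<exists>x\<in>K. \<forall>h\<in>H. \<phi> h x = x))"

definition amenable_relative ::
    "('g, 'm) monoid_scheme \<Rightarrow> 'g topology \<Rightarrow> 'g set \<Rightarrow> bool" where
  "amenable_relative G T H \<longleftrightarrow>
     fixes_points_over TYPE((real \<times> bool \<times> 'g) list set set) G T H"


subsection \<open>Independence of the type of vectors\<close>

lemma real_field_simps [simp]:
  "carrier real_field = UNIV" "x \<otimes>\<^bsub>real_field\<^esub> y = x * y" "\<one>\<^bsub>real_field\<^esub> = 1"
  "\<zero>\<^bsub>real_field\<^esub> = 0" "x \<oplus>\<^bsub>real_field\<^esub> y = x + y"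
  by (simp_all add: ring_of_type_algebra_def)

context hausdorff_lctvs
begin

lemma sm_closed [simp, intro]: "x \<in> carrier V \<Longrightarrow> a \<odot> x \<in> carrier V"
  using smult_closed by simp

lemma sm_l: "x \<in> carrier V \<Longrightarrow> (a + b) \<odot> x = a \<odot> x \<oplus> b \<odot> x"
  using smult_l_distr[of a b x] by simp

lemma sm_r: "x \<in> carrier V \<Longrightarrow> y \<in> carrier V \<Longrightarrow> a \<odot> (x \<oplus> y) = a \<odot> x \<oplus> a \<odot> y"
  using smult_r_distr[of a x y] by simp

lemma sm_assoc: "x \<in> carrier V \<Longrightarrow> (a * b) \<odot> x = a \<odot> (b \<odot> x)"
  using smult_assoc1[of a b x] by simp

lemma sm_one: "x \<in> carrier V \<Longrightarrow> 1 \<odot> x = x"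
  using smult_one[of x] by simp

lemma sm_0l: "x \<in> carrier V \<Longrightarrow> 0 \<odot> x = \<zero>\<^bsub>V\<^esub>"
  using smult_l_null[of x] by simp

lemma sm_0r: "a \<odot> \<zero>\<^bsub>V\<^esub> = \<zero>\<^bsub>V\<^esub>"
  using smult_r_null[of a] by simp

end

lemma transport_G_space:
  fixes V :: "(real, 'v, 'm) module_scheme" and c :: "'v \<Rightarrow> 'u"
  assumes sp: "convex_compact_G_space G T V \<tau> \<phi> K"
    and W: "W \<subseteq> carrier V" "\<zero>\<^bsub>V\<^esub> \<in> W"
    and Wadd: "\<And>x y. x \<in> W \<Longrightarrow> y \<in> W \<Longrightarrow> x \<oplus>\<^bsub>V\<^esub> y \<in> W"
    and Wsm: "\<And>a x. x \<in> W \<Longrightarrow> a \<odot>\<^bsub>V\<^esub> x \<in> W"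
    and Wact: "\<And>g x. g \<in> carrier G \<Longrightarrow> x \<in> W \<Longrightarrow> \<phi> g x \<in> W"
    and Wclosed: "closedin \<tau> W"
    and inj: "inj_on c W"
  obtains V' :: "(real, 'u) module" and \<tau>' \<phi>' where
    "convex_compact_G_space G T V' \<tau>' \<phi>' (c ` (K \<inter> W))"
    "\<And>g x. g \<in> carrier G \<Longrightarrow> x \<in> W \<Longrightarrow> \<phi>' g (c x) = c (\<phi> g x)"
proof -
  interpret convex_compact_G_space G T V \<tau> \<phi> K by fact
  define f where "f = inv_into W c"
  define N where "N = c ` W"
  have fc [simp]: "f (c x) = x" if "x \<in> W" for x
    using that inj by (simp add: f_def)
  have cf [simp]: "c (f u) = u" if "u \<in> N" for u
    using that by (auto simp: N_def)
  have fW [simp]: "f u \<in> W" if "u \<in> N" for u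
    using that by (auto simp: N_def)
  have cN [simp]: "c x \<in> N" if "x \<in> W" for x
    using that by (auto simp: N_def)
  have WV [simp]: "x \<in> carrier V" if "x \<in> W" for x
    using that W by auto
  note [simp] = Wadd Wsm Wact W(2)
  define V' :: "(real, 'u) module" where
    "V' = \<lparr>carrier = N, mult = undefined, one = undefined, zero = c \<zero>\<^bsub>V\<^esub>,
           add = (\<lambda>u v. c (f u \<oplus>\<^bsub>V\<^esub> f v)), smult = (\<lambda>a u. c (a \<odot>\<^bsub>V\<^esub> f u))\<rparr>"
  have V' [simp]: "carrier V' = N" "\<zero>\<^bsub>V'\<^esub> = c \<zero>\<^bsub>V\<^esub>" "u \<oplus>\<^bsub>V'\<^esub> v = c (f u \<oplus>\<^bsub>V\<^esub> f v)"
    "a \<odot>\<^bsub>V'\<^esub> u = c (a \<odot>\<^bsub>V\<^esub> f u)" for u v a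
    by (auto simp: V'_def)
  define \<tau>' where "\<tau>' = pullback_topology N f \<tau>"
  define \<phi>' where "\<phi>' = (\<lambda>g. restrict (\<lambda>u. c (\<phi> g (f u))) N)"
  have top [simp]: "topspace \<tau>' = N"
    by (auto simp: \<tau>'_def topspace_pullback_topology V.topspace_eq_carrier)
  have pre: "openin \<tau>' (f -` A \<inter> N)" if "openin \<tau> A" for A
    using that by (auto simp: \<tau>'_def openin_pullback_topology)
  have f_cont: "continuous_map \<tau>' \<tau> f"
    using continuous_map_pullback[of \<tau> \<tau> id N f] by (simp add: \<tau>'_def)
  have into_pullback: "continuous_map Y \<tau>' h" if "continuous_map Y \<tau> (f \<circ> h)" "h ` topspace Y \<subseteq> N"
    for Y :: "'z topology" and h
    unfolding \<tau>'_def using that by (intro continuous_map_pullback') auto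
  have c_cont: "continuous_map (subtopology \<tau> W) \<tau>' c"
    by (rule into_pullback)
       (auto intro: continuous_map_eq[OF continuous_map_from_subtopology[OF continuous_map_id]])
  have ab: "abelian_group V'"
  proof (rule abelian_groupI)
    fix x assume x: "x \<in> carrier V'"
    have "c ((-1) \<odot>\<^bsub>V\<^esub> f x) \<in> carrier V'"
      using x by simp
    moreover have "((-1) \<odot>\<^bsub>V\<^esub> f x) \<oplus>\<^bsub>V\<^esub> f x = \<zero>\<^bsub>V\<^esub>"
      using V.sm_l[of "f x" "-1" 1] x by (simp add: V.sm_one V.sm_0l)
    ultimately show "\<exists>y\<in>carrier V'. y \<oplus>\<^bsub>V'\<^esub> x = \<zero>\<^bsub>V'\<^esub>"
      using x by (intro bexI[of _ "c ((-1) \<odot>\<^bsub>V\<^esub> f x)"]) auto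
  qed (auto simp: V.M.a_assoc intro!: arg_cong[where f = c] V.M.a_comm)
  have mod: "module real_field V'"
    by (rule moduleI)
       (use ab V.R.is_cring in \<open>auto simp: V.sm_l V.sm_r V.sm_assoc V.sm_one\<close>)
  have "hausdorff_lctvs V' \<tau>'"
  proof (intro hausdorff_lctvs.intro hausdorff_lctvs_axioms.intro mod)
    show "topspace \<tau>' = carrier V'" by simp
    show "Hausdorff_space \<tau>'"
      unfolding Hausdorff_space_def
    proof (intro allI impI)
      fix u v assume uv: "u \<in> topspace \<tau>' \<and> v \<in> topspace \<tau>' \<and> u \<noteq> v"
      then have "f u \<noteq> f v" by (metis cf top)
      then obtain A B where "openin \<tau> A" "openin \<tau> B" "f u \<in> A" "f v \<in> B" "disjnt A B"
        using V.Hausdorff uv V.topspace_eq_carrier unfolding Hausdorff_space_def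
        by (metis WV fW top)
      moreover have "u \<in> N" "v \<in> N"
        using uv by simp_all
      ultimately show "\<exists>U V. openin \<tau>' U \<and> openin \<tau>' V \<and> u \<in> U \<and> v \<in> V \<and> disjnt U V"
        by (intro exI[of _ "f -` A \<inter> N"] exI[of _ "f -` B \<inter> N"] conjI pre)
           (auto simp: disjnt_iff)
    qed
    show "continuous_map (prod_topology \<tau>' \<tau>') \<tau>' (\<lambda>(x, y). x \<oplus>\<^bsub>V'\<^esub> y)"
    proof (rule into_pullback)
      have "continuous_map (prod_topology \<tau>' \<tau>') \<tau> ((\<lambda>(x, y). x \<oplus>\<^bsub>V\<^esub> y) \<circ> (\<lambda>(u, v). (f u, f v)))"
        by (intro continuous_map_compose[OF _ V.continuous_add] continuous_map_prod_top[THEN iffD2])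
           (use f_cont in auto)
      then show "continuous_map (prod_topology \<tau>' \<tau>') \<tau> (f \<circ> (\<lambda>(x, y). x \<oplus>\<^bsub>V'\<^esub> y))"
        by (rule continuous_map_eq) auto
    qed auto
    show "continuous_map (prod_topology euclideanreal \<tau>') \<tau>' (\<lambda>(a, x). a \<odot>\<^bsub>V'\<^esub> x)"
    proof (rule into_pullback)
      have "continuous_map (prod_topology euclideanreal \<tau>') \<tau>
              ((\<lambda>(a, x). a \<odot>\<^bsub>V\<^esub> x) \<circ> (\<lambda>(a, v). (id a, f v)))"
        by (intro continuous_map_compose[OF _ V.continuous_smult] continuous_map_prod_top[THEN iffD2])
           (use f_cont in auto)
      then show "continuous_map (prod_topology euclideanreal \<tau>') \<tau> (f \<circ> (\<lambda>(a, x). a \<odot>\<^bsub>V'\<^esub> x))"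
        by (rule continuous_map_eq) auto
    qed auto
    show "neighbourhood_base_of (convex_in V') \<tau>'"
      unfolding neighbourhood_base_of
    proof (intro allI impI)
      fix A u assume A: "openin \<tau>' A \<and> u \<in> A"
      then obtain B where B: "openin \<tau> B" "A = f -` B \<inter> N"
        by (auto simp: \<tau>'_def openin_pullback_topology)
      have "openin \<tau> B \<and> f u \<in> B"
        using A B by simp
      then obtain C D where "openin \<tau> C" "convex_in V D" "f u \<in> C" "C \<subseteq> D" "D \<subseteq> B"
        using V.locally_convex[unfolded neighbourhood_base_of, rule_format, of B "f u"] by auto
      moreover have "convex_in V' (f -` D \<inter> N)"
        unfolding convex_in_def
      proof (intro conjI ballI allI impI)
        fix x y :: 'u and t :: real
        assume xy: "x \<in> f -` D \<inter> N" "y \<in> f -` D \<inter> N" and t: "0 \<le> t \<and> t \<le> 1"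
        then have "((1 - t) \<odot>\<^bsub>V\<^esub> f x) \<oplus>\<^bsub>V\<^esub> (t \<odot>\<^bsub>V\<^esub> f y) \<in> D"
          using \<open>convex_in V D\<close> unfolding convex_in_def by blast
        then show "((1 - t) \<odot>\<^bsub>V'\<^esub> x) \<oplus>\<^bsub>V'\<^esub> (t \<odot>\<^bsub>V'\<^esub> y) \<in> f -` D \<inter> N"
          using xy by simp
      qed simp
      ultimately show "\<exists>U V. openin \<tau>' U \<and> convex_in V' V \<and> u \<in> U \<and> U \<subseteq> V \<and> V \<subseteq> A"
        using A B
        by (intro exI[of _ "f -` C \<inter> N"] exI[of _ "f -` D \<inter> N"] conjI pre) auto
    qed
  qed
  moreover have "group_action G (carrier V') \<phi>'"
  proof -
    have comp: "\<phi> (g \<otimes>\<^bsub>G\<^esub> h) x = \<phi> g (\<phi> h x)"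
      if "g \<in> carrier G" "h \<in> carrier G" "x \<in> W" for g h x
      using act.composition_rule that by simp
    have one: "\<phi> \<one>\<^bsub>G\<^esub> x = x" if "x \<in> W" for x
      using act.id_eq_one that by (metis WV restrict_apply')
    have bij: "\<phi>' g \<in> Bij N" if g: "g \<in> carrier G" for g
    proof -
      have "bij_betw (\<phi>' g) N N"
      proof (rule bij_betw_byWitness[where f' = "\<phi>' (inv\<^bsub>G\<^esub> g)"])
        show "\<forall>a\<in>N. \<phi>' (inv\<^bsub>G\<^esub> g) (\<phi>' g a) = a"
          using g by (auto simp: \<phi>'_def comp[symmetric] one)
        show "\<forall>a\<in>N. \<phi>' g (\<phi>' (inv\<^bsub>G\<^esub> g) a) = a"
          using g by (auto simp: \<phi>'_def comp[symmetric] one)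
      qed (use g in \<open>auto simp: \<phi>'_def\<close>)
      then show ?thesis
        by (auto simp: Bij_def \<phi>'_def)
    qed
    have "\<phi>' \<in> hom G (BijGroup N)"
    proof (rule homI)
      fix g h assume gh: "g \<in> carrier G" "h \<in> carrier G"
      show "\<phi>' (g \<otimes>\<^bsub>G\<^esub> h) = \<phi>' g \<otimes>\<^bsub>BijGroup N\<^esub> \<phi>' h"
        using gh bij
        by (auto simp: BijGroup_def fun_eq_iff compose_def \<phi>'_def comp restrict_def)
    qed (use bij in \<open>auto simp: BijGroup_def\<close>)
    then show ?thesis
      by (simp add: group_action_def group_hom_def group_hom_axioms_def group_BijGroup
          G.is_group)
  qed
  moreover have "convex_compact_G_space_axioms G T V' \<tau>' \<phi>' (c ` (K \<inter> W))"
  proof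
    show "affine_on V' (\<phi>' g)" if "g \<in> carrier G" for g
      using affine_action[OF that] that by (auto simp: affine_on_def \<phi>'_def)
    show "continuous_map (prod_topology T \<tau>') \<tau>' (\<lambda>(g, v). \<phi>' g v)"
    proof (rule into_pullback)
      have "continuous_map (prod_topology T \<tau>') \<tau> ((\<lambda>(g, v). \<phi> g v) \<circ> (\<lambda>(g, v). (id g, f v)))"
        by (intro continuous_map_compose[OF _ continuous_action] continuous_map_prod_top[THEN iffD2])
           (use f_cont in auto)
      then show "continuous_map (prod_topology T \<tau>') \<tau> (f \<circ> (\<lambda>(g, v). \<phi>' g v))"
        by (rule continuous_map_eq) (auto simp: \<phi>'_def G.topspace_eq_carrier)
    qed (auto simp: \<phi>'_def G.topspace_eq_carrier)
    show "convex_in V' (c ` (K \<inter> W))"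
      unfolding convex_in_def
    proof (intro conjI ballI allI impI)
      fix u v and t :: real
      assume uv: "u \<in> c ` (K \<inter> W)" "v \<in> c ` (K \<inter> W)" and t: "0 \<le> t \<and> t \<le> 1"
      then obtain x y where xy: "u = c x" "v = c y" "x \<in> K" "y \<in> K" "x \<in> W" "y \<in> W"
        by blast
      then have "((1 - t) \<odot>\<^bsub>V\<^esub> x) \<oplus>\<^bsub>V\<^esub> (t \<odot>\<^bsub>V\<^esub> y) \<in> K \<inter> W"
        using convex t unfolding convex_in_def by simp
      then show "((1 - t) \<odot>\<^bsub>V'\<^esub> u) \<oplus>\<^bsub>V'\<^esub> (t \<odot>\<^bsub>V'\<^esub> v) \<in> c ` (K \<inter> W)"
        using xy by simp
    qed auto
    have "compactin (subtopology \<tau> W) (K \<inter> W)"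
      using compact Wclosed by (simp add: compactin_subtopology compact_Int_closedin)
    then show "compactin \<tau>' (c ` (K \<inter> W))"
      using c_cont image_compactin by blast
    show "\<phi>' g ` (c ` (K \<inter> W)) \<subseteq> c ` (K \<inter> W)" if "g \<in> carrier G" for g
      using preserved[OF that] that by (auto simp: \<phi>'_def)
  qed
  ultimately have "convex_compact_G_space G T V' \<tau>' \<phi>' (c ` (K \<inter> W))"
    by (intro convex_compact_G_space.intro G.topological_group_axioms)
  moreover have "\<phi>' g (c x) = c (\<phi> g x)" if "g \<in> carrier G" "x \<in> W" for g x
    using that by (simp add: \<phi>'_def)
  ultimately show thesis
    using that by blast
qed

text \<open>
  A point of a convex compact G-space lies in the closed span of its orbit and the orbit of the
  origin. The points of this closed invariant subspace are determined by the traces of their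
  neighbourhoods on formal linear combinations.
\<close>

lemma small_invariant_subspace:
  fixes V :: "(real, 'v, 'm) module_scheme" and G :: "('g, 'n) monoid_scheme"
  assumes sp: "convex_compact_G_space G T V \<tau> \<phi> K" and x0: "x0 \<in> K"
  obtains W and c :: "'v \<Rightarrow> (real \<times> bool \<times> 'g) list set set" where
    "W \<subseteq> carrier V" "\<zero>\<^bsub>V\<^esub> \<in> W" "x0 \<in> W" "closedin \<tau> W" "inj_on c W"
    "\<And>x y. x \<in> W \<Longrightarrow> y \<in> W \<Longrightarrow> x \<oplus>\<^bsub>V\<^esub> y \<in> W"
    "\<And>a x. x \<in> W \<Longrightarrow> a \<odot>\<^bsub>V\<^esub> x \<in> W"
    "\<And>g x. g \<in> carrier G \<Longrightarrow> x \<in> W \<Longrightarrow> \<phi> g x \<in> W"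
proof -
  interpret convex_compact_G_space G T V \<tau> \<phi> K by fact
  have x0V: "x0 \<in> carrier V"
    using convex x0 by (auto simp: convex_in_def)
  have actV [simp]: "\<phi> g x \<in> carrier V" if "g \<in> carrier G" "x \<in> carrier V" for g x
    using act.element_image that by blast
  define p where "p = (\<lambda>(b, g). \<phi> g (if b then x0 else \<zero>\<^bsub>V\<^esub>))"
  define ev where "ev = (\<lambda>l. foldr (\<lambda>(a, i) v. (a \<odot>\<^bsub>V\<^esub> p i) \<oplus>\<^bsub>V\<^esub> v) l \<zero>\<^bsub>V\<^esub>)"
  have ev_simps [simp]: "ev [] = \<zero>\<^bsub>V\<^esub>" "ev ((a, i) # l) = (a \<odot>\<^bsub>V\<^esub> p i) \<oplus>\<^bsub>V\<^esub> ev l" for a i l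
    by (simp_all add: ev_def)
  define L :: "(real \<times> bool \<times> 'g) list set" where "L = lists (UNIV \<times> UNIV \<times> carrier G)"
  define S where "S = ev ` L"
  have pV [simp]: "p (b, g) \<in> carrier V" if "g \<in> carrier G" for b g
    using that x0V by (auto simp: p_def)
  have evV [simp]: "ev l \<in> carrier V" if "l \<in> L" for l
    using that unfolding L_def by (induction l) auto
  have SV: "S \<subseteq> carrier V"
    by (auto simp: S_def)
  have S0: "\<zero>\<^bsub>V\<^esub> \<in> S"
    unfolding S_def L_def by (rule image_eqI[of _ _ "[]"]) auto
  have ev_append: "ev (l @ m) = ev l \<oplus>\<^bsub>V\<^esub> ev m" if "l \<in> L" "m \<in> L" for l m
    using that(1) unfolding L_def
  proof (induction l)
    case (Cons i l)
    then show ?case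
      using evV[of l] evV[OF that(2)] by (cases i) (auto simp: V.M.a_assoc L_def)
  qed (use that in auto)
  have Sadd: "x \<oplus>\<^bsub>V\<^esub> y \<in> S" if xy: "x \<in> S" "y \<in> S" for x y
  proof -
    obtain l m where "l \<in> L" "m \<in> L" "x = ev l" "y = ev m"
      using xy by (auto simp: S_def)
    then show ?thesis
      unfolding S_def by (intro image_eqI[of _ _ "l @ m"]) (auto simp: ev_append L_def)
  qed
  have Sp: "a \<odot>\<^bsub>V\<^esub> p (b, g) \<in> S" if "g \<in> carrier G" for a b g
    unfolding S_def using that
    by (intro image_eqI[of _ _ "[(a, b, g)]"]) (auto simp: L_def)
  have Ssm: "a \<odot>\<^bsub>V\<^esub> x \<in> S" if x: "x \<in> S" for a x
  proof -
    have "a \<odot>\<^bsub>V\<^esub> ev l \<in> S" if "l \<in> L" for l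
      using that unfolding L_def
    proof (induction l)
      case (Cons i l)
      obtain r b g where i: "i = (r, b, g)" by (cases i)
      have g: "g \<in> carrier G" and l: "l \<in> L"
        using Cons i by (auto simp: L_def)
      have "a \<odot>\<^bsub>V\<^esub> ev (i # l) = ((a * r) \<odot>\<^bsub>V\<^esub> p (b, g)) \<oplus>\<^bsub>V\<^esub> (a \<odot>\<^bsub>V\<^esub> ev l)"
        using g l by (simp add: i V.sm_r V.sm_assoc)
      then show ?case
        using Cons g by (simp add: Sadd Sp)
    qed (use S0 in \<open>simp add: V.sm_0r\<close>)
    then show ?thesis using x by (auto simp: S_def)
  qed
  have pact: "\<phi> g (p (b, h)) = p (b, g \<otimes>\<^bsub>G\<^esub> h)" if "g \<in> carrier G" "h \<in> carrier G" for g b h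
    using that x0V by (auto simp: p_def act.composition_rule)
  have Sp1: "p (b, g) \<in> S" if "g \<in> carrier G" for b g
    using Sp[OF that, of 1 b] that by (simp add: V.sm_one)
  have aff: "\<phi> g (((1 - t) \<odot>\<^bsub>V\<^esub> x) \<oplus>\<^bsub>V\<^esub> (t \<odot>\<^bsub>V\<^esub> y)) =
               ((1 - t) \<odot>\<^bsub>V\<^esub> \<phi> g x) \<oplus>\<^bsub>V\<^esub> (t \<odot>\<^bsub>V\<^esub> \<phi> g y)"
    if "g \<in> carrier G" "x \<in> carrier V" "y \<in> carrier V" for g t x y
    using affine_action[OF that(1)] that by (simp add: affine_on_def)
  have Sact: "\<phi> g x \<in> S" if g: "g \<in> carrier G" and x: "x \<in> S" for g x
  proof -
    have z: "\<phi> g \<zero>\<^bsub>V\<^esub> \<in> S"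
      using Sp1[OF g, of False] by (simp add: p_def)
    have scale: "\<phi> g (t \<odot>\<^bsub>V\<^esub> y) \<in> S" if y: "y \<in> carrier V" "\<phi> g y \<in> S" for t y
    proof -
      have "\<phi> g (t \<odot>\<^bsub>V\<^esub> y) = ((1 - t) \<odot>\<^bsub>V\<^esub> \<phi> g \<zero>\<^bsub>V\<^esub>) \<oplus>\<^bsub>V\<^esub> (t \<odot>\<^bsub>V\<^esub> \<phi> g y)"
        using aff[of g "\<zero>\<^bsub>V\<^esub>" y t] g y by (simp add: V.sm_0r)
      then show ?thesis using y z by (simp add: Sadd Ssm)
    qed
    have add: "\<phi> g (x \<oplus>\<^bsub>V\<^esub> y) \<in> S"
      if xy: "x \<in> carrier V" "y \<in> carrier V" "\<phi> g x \<in> S" "\<phi> g y \<in> S" for x y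
    proof -
      let ?m = "((1 - 1/2) \<odot>\<^bsub>V\<^esub> x) \<oplus>\<^bsub>V\<^esub> ((1/2) \<odot>\<^bsub>V\<^esub> y)"
      have "\<phi> g ?m \<in> S"
        using aff[of g x y "1/2"] g xy by (simp add: Sadd Ssm)
      then have "\<phi> g (2 \<odot>\<^bsub>V\<^esub> ?m) \<in> S"
        using xy by (intro scale) auto
      moreover have "2 \<odot>\<^bsub>V\<^esub> ?m = x \<oplus>\<^bsub>V\<^esub> y"
        using xy V.sm_assoc[of _ 2 "1/2"] by (simp add: V.sm_r V.sm_one)
      ultimately show ?thesis by simp
    qed
    have "\<phi> g (ev l) \<in> S" if "l \<in> L" for l
      using that unfolding L_def
    proof (induction l)
      case (Cons i l)
      obtain r b h where i: "i = (r, b, h)" by (cases i)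
      have h: "h \<in> carrier G" and l: "l \<in> L"
        using Cons i by (auto simp: L_def)
      have "\<phi> g (r \<odot>\<^bsub>V\<^esub> p (b, h)) \<in> S"
        using g h by (intro scale) (auto simp: pact Sp1)
      then show ?case
        using Cons g h l by (auto simp: i intro!: add)
    qed (use z in simp)
    then show ?thesis using x by (auto simp: S_def)
  qed
  define W where "W = \<tau> closure_of S"
  have SW: "S \<subseteq> W"
    unfolding W_def using SV by (simp add: closure_of_subset V.topspace_eq_carrier)
  have WV: "W \<subseteq> carrier V"
    unfolding W_def by (metis closure_of_subset_topspace V.topspace_eq_carrier)
  have W0: "\<zero>\<^bsub>V\<^esub> \<in> W"
    using SW S0 by auto
  have "x0 = p (True, \<one>\<^bsub>G\<^esub>)"
    using act.id_eq_one x0V unfolding p_def by (auto simp: fun_eq_iff dest!: spec[of _ x0])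
  then have Wx0: "x0 \<in> W"
    using SW Sp1[of "\<one>\<^bsub>G\<^esub>" True] by auto
  have Wadd: "x \<oplus>\<^bsub>V\<^esub> y \<in> W" if "x \<in> W" "y \<in> W" for x y
  proof -
    have "(x, y) \<in> prod_topology \<tau> \<tau> closure_of (S \<times> S)"
      using that by (simp add: closure_of_Times W_def)
    then have "x \<oplus>\<^bsub>V\<^esub> y \<in> \<tau> closure_of ((\<lambda>(x, y). x \<oplus>\<^bsub>V\<^esub> y) ` (S \<times> S))"
      using continuous_map_image_closure_subset[OF V.continuous_add, of "S \<times> S"] by force
    moreover have "(\<lambda>(x, y). x \<oplus>\<^bsub>V\<^esub> y) ` (S \<times> S) \<subseteq> S"
      using Sadd by auto
    ultimately show ?thesis
      unfolding W_def using closure_of_mono by blast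
  qed
  have Wsm: "a \<odot>\<^bsub>V\<^esub> x \<in> W" if "x \<in> W" for a x
  proof -
    have "continuous_map \<tau> \<tau> ((\<lambda>(a, x). a \<odot>\<^bsub>V\<^esub> x) \<circ> (\<lambda>x. (a, x)))"
      by (intro continuous_map_compose[OF _ V.continuous_smult]) (auto simp: continuous_map_pairwise o_def)
    then have "continuous_map \<tau> \<tau> (\<lambda>x. a \<odot>\<^bsub>V\<^esub> x)"
      by (simp add: o_def)
    then have "a \<odot>\<^bsub>V\<^esub> x \<in> \<tau> closure_of ((\<lambda>x. a \<odot>\<^bsub>V\<^esub> x) ` S)"
      using continuous_map_image_closure_subset that unfolding W_def by blast
    moreover have "(\<lambda>x. a \<odot>\<^bsub>V\<^esub> x) ` S \<subseteq> S"
      using Ssm by auto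
    ultimately show ?thesis
      unfolding W_def using closure_of_mono by blast
  qed
  have Wact: "\<phi> g x \<in> W" if g: "g \<in> carrier G" and x: "x \<in> W" for g x
  proof -
    have "continuous_map \<tau> \<tau> ((\<lambda>(a, x). \<phi> a x) \<circ> (\<lambda>x. (g, x)))"
      by (intro continuous_map_compose[OF _ continuous_action])
         (use g in \<open>auto simp: continuous_map_pairwise o_def G.topspace_eq_carrier\<close>)
    then have "continuous_map \<tau> \<tau> (\<lambda>x. \<phi> g x)"
      by (simp add: o_def)
    then have "\<phi> g x \<in> \<tau> closure_of ((\<lambda>x. \<phi> g x) ` S)"
      using continuous_map_image_closure_subset x unfolding W_def by blast
    moreover have "(\<lambda>x. \<phi> g x) ` S \<subseteq> S"
      using Sact g by auto
    ultimately show ?thesis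
      unfolding W_def using closure_of_mono by blast
  qed
  define c where "c = (\<lambda>w. {{l \<in> L. ev l \<in> U} | U. openin \<tau> U \<and> w \<in> U})"
  have "inj_on c W"
  proof (rule inj_onI, rule ccontr)
    fix w w' assume w: "w \<in> W" "w' \<in> W" "c w = c w'" "w \<noteq> w'"
    then have "w \<in> topspace \<tau>" "w' \<in> topspace \<tau>"
      using WV V.topspace_eq_carrier by auto
    then obtain A B where A: "openin \<tau> A" "openin \<tau> B" "w \<in> A" "w' \<in> B" "disjnt A B"
      using V.Hausdorff w unfolding Hausdorff_space_def by metis
    then have "{l \<in> L. ev l \<in> A} \<in> c w'"
      using w(3) unfolding c_def by blast
    then obtain C where C: "{l \<in> L. ev l \<in> A} = {l \<in> L. ev l \<in> C}" "openin \<tau> C" "w' \<in> C"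
      unfolding c_def by blast
    have "openin \<tau> (B \<inter> C)" "w' \<in> B \<inter> C"
      using A C by auto
    then obtain l where "l \<in> L" "ev l \<in> B \<inter> C"
      using w(2) unfolding W_def S_def in_closure_of by blast
    then show False
      using A C by (auto simp: disjnt_iff)
  qed
  then show thesis
    using that WV W0 Wx0 Wadd Wsm Wact by (metis W_def closedin_closure_of)
qed

lemma amenable_relative_fixes_point:
  fixes V :: "(real, 'v, 'm) module_scheme"
  assumes "amenable_relative G T H" "H \<subseteq> carrier G"
    and sp: "convex_compact_G_space G T V \<tau> \<phi> K" and "K \<noteq> {}"
  shows "\<exists>x\<in>K. \<forall>h\<in>H. \<phi> h x = x"
proof -
  obtain x0 where x0: "x0 \<in> K"
    using \<open>K \<noteq> {}\<close> by auto
  obtain W and c :: "'v \<Rightarrow> (real \<times> bool \<times> 'a) list set set" where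
    W: "W \<subseteq> carrier V" "\<zero>\<^bsub>V\<^esub> \<in> W" "x0 \<in> W" "closedin \<tau> W" "inj_on c W"
    "\<And>x y. x \<in> W \<Longrightarrow> y \<in> W \<Longrightarrow> x \<oplus>\<^bsub>V\<^esub> y \<in> W"
    "\<And>a x. x \<in> W \<Longrightarrow> a \<odot>\<^bsub>V\<^esub> x \<in> W"
    "\<And>g x. g \<in> carrier G \<Longrightarrow> x \<in> W \<Longrightarrow> \<phi> g x \<in> W"
    using small_invariant_subspace[OF sp x0] by blast
  obtain V' :: "(real, (real \<times> bool \<times> 'a) list set set) module" and \<tau>' \<phi>' where
    V': "convex_compact_G_space G T V' \<tau>' \<phi>' (c ` (K \<inter> W))"
    "\<And>g x. g \<in> carrier G \<Longrightarrow> x \<in> W \<Longrightarrow> \<phi>' g (c x) = c (\<phi> g x)"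
    using transport_G_space[OF sp W(1,2,6,7,8,4,5)] by blast
  have "c ` (K \<inter> W) \<noteq> {}"
    using x0 W by auto
  then obtain x where x: "x \<in> K" "x \<in> W" "\<forall>h\<in>H. \<phi>' h (c x) = c x"
    using assms(1) V'(1) unfolding amenable_relative_def fixes_points_over_def by blast
  have "\<phi> h x = x" if "h \<in> H" for h
    using x that V'(2)[of h x] W(5,8) assms(2) by (metis inj_onD subsetD)
  then show ?thesis
    using x by blast
qed

end

theory Submission
  imports Defs
begin

text \<open>
  Fix a convex compact \<open>G\<close>-space \<open>K\<close>. Fixing a point of \<open>K\<close> is a Chabauty-closed condition on
  closed subgroups, and the relatively amenable subgroups are cut out by these conditions, one for
  each non-empty \<open>K\<close>.

  In terms of nets, the condition is closed because, if \<open>L\<^sub>i\<close> fixes \<open>x\<^sub>i \<in> K\<close> and \<open>L\<^sub>i\<close> converges to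
  \<open>H\<close>, then \<open>x\<^sub>i\<close> may be assumed to converge to some \<open>x \<in> K\<close> by compactness. Every \<open>h \<in> H\<close> is a
  limit of elements \<open>h\<^sub>i \<in> L\<^sub>i\<close> along a subnet, and \<open>h\<^sub>i x\<^sub>i = x\<^sub>i\<close> passes to the limit \<open>h x = x\<close>,
  because the action is jointly continuous and the space is Hausdorff. The formal argument
  is the contrapositive, in which finite subcovers replace nets: a subgroup without fixed point in
  \<open>K\<close> already moves every point of \<open>K\<close> through finitely many open sets of group elements, and
  any subgroup that meets each of these open sets has no fixed point either
  (\<open>closedin_chabauty_fixing_point\<close>).
\<close>

lemma openin_chabauty_meets:
  assumes "openin T U"
  shows "openin (chabauty_topology G T) {L \<in> closed_subgroups G T. L \<inter> U \<noteq> {}}"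
  unfolding chabauty_topology_def using assms by (intro topology_generated_by_Basis) blast

text \<open>
  The pairs \<open>(g, v)\<close> with \<open>g v \<noteq> v\<close> form an open set, being the preimage of the complement of the
  closed diagonal. Rectangles inside this set carry the compactness argument below.
\<close>

lemma (in convex_compact_G_space) moved_point_rectangle:
  assumes h: "h \<in> carrier G" and x: "x \<in> carrier V" and moved: "\<phi> h x \<noteq> x"
  obtains U W where "openin T U" "openin \<tau> W" "h \<in> U" "x \<in> W"
    "\<And>u w. u \<in> U \<Longrightarrow> w \<in> W \<Longrightarrow> \<phi> u w \<noteq> w"
proof -
  let ?X = "prod_topology T \<tau>"
  let ?M = "{p \<in> topspace ?X. (case p of (g, v) \<Rightarrow> \<phi> g v) \<noteq> snd p}"
  have "closedin ?X {p \<in> topspace ?X. (case p of (g, v) \<Rightarrow> \<phi> g v) = snd p}"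
    by (intro closedin_continuous_maps_eq[OF V.Hausdorff continuous_action] continuous_map_snd)
  then have "openin ?X (topspace ?X - {p \<in> topspace ?X. (case p of (g, v) \<Rightarrow> \<phi> g v) = snd p})"
    by blast
  also have "topspace ?X - {p \<in> topspace ?X. (case p of (g, v) \<Rightarrow> \<phi> g v) = snd p} = ?M"
    by blast
  finally have "openin ?X ?M" .
  moreover have "(h, x) \<in> ?M"
    using h x moved by (simp add: G.topspace_eq_carrier V.topspace_eq_carrier)
  ultimately have "\<exists>U W. openin T U \<and> openin \<tau> W \<and> h \<in> U \<and> x \<in> W \<and> U \<times> W \<subseteq> ?M"
    by (rule openin_prod_topology_alt[THEN iffD1, rule_format])
  then obtain U W where UW: "openin T U" "openin \<tau> W" "h \<in> U" "x \<in> W" "U \<times> W \<subseteq> ?M"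
    by (elim exE conjE)
  from UW(5) have "\<phi> u w \<noteq> w" if "u \<in> U" "w \<in> W" for u w
    using that by auto
  with UW that show thesis by blast
qed

lemma (in convex_compact_G_space) closedin_chabauty_fixing_point:
  "closedin (chabauty_topology G T)
     {L \<in> closed_subgroups G T. \<exists>x\<in>K. \<forall>h\<in>L. \<phi> h x = x}"
proof -
  let ?C = "chabauty_topology G T" and ?S = "closed_subgroups G T"
  let ?N = "{L \<in> ?S. \<forall>x\<in>K. \<exists>h\<in>L. \<phi> h x \<noteq> x}"
  have "\<exists>\<N>. openin ?C \<N> \<and> H \<in> \<N> \<and> \<N> \<subseteq> ?N" if H: "H \<in> ?N" for H
  proof -
    have Hsub: "H \<subseteq> carrier G"
      using H by (auto simp: closed_subgroups_def dest: subgroup.subset)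
    have KV: "K \<subseteq> carrier V"
      using convex by (simp add: convex_in_def)
    \<comment> \<open>Given \<open>moves U W\<close>, no subgroup that meets \<open>U\<close> fixes a point of \<open>W\<close>, and \<open>H\<close> is one of them.\<close>
    define moves where "moves U W \<longleftrightarrow> openin T U \<and> H \<inter> U \<noteq> {} \<and> (\<forall>u\<in>U. \<forall>w\<in>W. \<phi> u w \<noteq> w)"
      for U W
    define \<W> where "\<W> = {W. openin \<tau> W \<and> (\<exists>U. moves U W)}"
    have "K \<subseteq> \<Union>\<W>"
    proof
      fix x assume x: "x \<in> K"
      obtain h where h: "h \<in> H" "\<phi> h x \<noteq> x"
        using H x by blast
      then have "h \<in> carrier G" "x \<in> carrier V"
        using Hsub KV x by auto
      then obtain U W where UW: "openin T U" "openin \<tau> W" "h \<in> U" "x \<in> W"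
        "\<And>u w. u \<in> U \<Longrightarrow> w \<in> W \<Longrightarrow> \<phi> u w \<noteq> w"
        using moved_point_rectangle h(2) by metis
      then have "moves U W"
        using h(1) unfolding moves_def by blast
      then show "x \<in> \<Union>\<W>"
        using UW(2,4) unfolding \<W>_def by blast
    qed
    then have "\<exists>\<F>. finite \<F> \<and> \<F> \<subseteq> \<W> \<and> K \<subseteq> \<Union>\<F>"
      by (intro compactinD[OF compact]) (auto simp: \<W>_def)
    then obtain \<F> where \<F>: "finite \<F>" "\<F> \<subseteq> \<W>" "K \<subseteq> \<Union>\<F>"
      by (elim exE conjE)
    have "\<forall>W\<in>\<F>. \<exists>U. moves U W"
      using \<F>(2) by (auto simp: \<W>_def)
    then have "\<exists>U. \<forall>W\<in>\<F>. moves (U W) W"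
      by (rule bchoice)
    then obtain U where U: "\<And>W. W \<in> \<F> \<Longrightarrow> moves (U W) W"
      by blast
    \<comment> \<open>Intersecting with the whole space keeps the neighbourhood open when \<open>\<F>\<close> is empty.\<close>
    define \<N> where "\<N> = topspace ?C \<inter> \<Inter>((\<lambda>W. {L \<in> ?S. L \<inter> U W \<noteq> {}}) ` \<F>)"
    have "openin ?C \<N>"
      unfolding \<N>_def
    proof (rule openin_Int_Inter)
      show "openin ?C A" if "A \<in> (\<lambda>W. {L \<in> ?S. L \<inter> U W \<noteq> {}}) ` \<F>" for A
        using that U openin_chabauty_meets unfolding moves_def by blast
    qed (use \<F>(1) in auto)
    moreover have "H \<in> \<N>"
      using H U unfolding \<N>_def topspace_chabauty_topology moves_def by blast
    moreover have "\<N> \<subseteq> ?N"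
    proof (intro subsetI CollectI conjI ballI)
      show "L \<in> ?S" if "L \<in> \<N>" for L
        using that unfolding \<N>_def topspace_chabauty_topology by blast
      fix L x assume L: "L \<in> \<N>" and x: "x \<in> K"
      obtain W where W: "W \<in> \<F>" "x \<in> W"
        using \<F>(3) x by blast
      then obtain u where "u \<in> L" "u \<in> U W"
        using L unfolding \<N>_def by blast
      then show "\<exists>h\<in>L. \<phi> h x \<noteq> x"
        using U[OF W(1)] W(2) unfolding moves_def by blast
    qed
    ultimately show ?thesis by blast
  qed
  then have "openin ?C ?N"
    by (subst openin_subopen) blast
  moreover have "?S - {L \<in> ?S. \<exists>x\<in>K. \<forall>h\<in>L. \<phi> h x = x} = ?N"
    by blast
  ultimately show ?thesis
    by (simp add: closedin_def topspace_chabauty_topology)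
qed

theorem lemma18:
  fixes G :: "('g, 'm) monoid_scheme" and T :: "'g topology"
  assumes "locally_compact_group G T"
  shows "closedin (chabauty_topology G T)
           {H \<in> closed_subgroups G T. amenable_relative G T H}"
proof -
  let ?C = "chabauty_topology G T" and ?S = "closed_subgroups G T"
  let ?A = "{H \<in> ?S. amenable_relative G T H}"
  have "H \<in> ?A" if H: "H \<in> ?C closure_of ?A" for H
  proof -
    have "H \<in> ?S"
      using H closure_of_subset_topspace[of ?C ?A] by (simp add: topspace_chabauty_topology subset_iff)
    moreover have "amenable_relative G T H"
      unfolding amenable_relative_def fixes_points_over_def
    proof (intro allI impI)
      fix V :: "(real, (real \<times> bool \<times> 'g) list set set) module" and \<tau> \<phi> K
      assume K: "convex_compact_G_space G T V \<tau> \<phi> K \<and> K \<noteq> {}"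
      let ?F = "{L \<in> ?S. \<exists>x\<in>K. \<forall>h\<in>L. \<phi> h x = x}"
      have "\<exists>x\<in>K. \<forall>h\<in>L. \<phi> h x = x" if "amenable_relative G T L" for L
        using that K
        by (intro that[unfolded amenable_relative_def fixes_points_over_def, rule_format])
      then have "?A \<subseteq> ?F"
        by blast
      moreover have "closedin ?C ?F"
        by (rule convex_compact_G_space.closedin_chabauty_fixing_point[OF conjunct1[OF K]])
      ultimately have "?C closure_of ?A \<subseteq> ?F"
        by (rule closure_of_minimal)
      then show "\<exists>x\<in>K. \<forall>h\<in>H. \<phi> h x = x"
        using H by blast
    qed
    ultimately show ?thesis
      by simp
  qed
  then have "?C closure_of ?A \<subseteq> ?A"
    by (rule subsetI)
  moreover have "?A \<subseteq> topspace ?C"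
    unfolding topspace_chabauty_topology by blast
  ultimately show ?thesis
    by (simp only: closure_of_subset_eq[symmetric])
qed

end
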